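(* Hall's universal locally finite group $U$ has the following combination of properties: (1) $U$ is mitotic; (2) $U$ has commuting $\mathbb{Z}/n$-conjugates for every integer $n \geq 2$; (3) $U$ does not have commuting $\mathbb{Z}$-conjugates.
   Context: Hall's universal locally finite group $U$ is the countable locally finite group such that every finite group embeds into $U$, and any two embeddings of a given finite group into $U$ are conjugate by an element of $U$. We write ${}^t g = tgt^{-1}$ and ${}^t H = tHt^{-1}$. A group $\Gamma$ is *mitotic* if for every finitely generated subgroup $H \leq \Gamma$ there exist $t_1, t_2 \in \Gamma$ such that $[H, {}^{t_1} H] = 1$ and ${}^{t_2} h = h \cdot {}^{t_1} h$ for all $h \in H$. For an integer $n \geq 2$, $\Gamma$ has *commuting $\mathbb{Z}/n$-conjugates* if for every finitely generated subgroup $H \leq \Gamma$ there exists $t \in \Gamma$ such that $[H, {}^{t^p} H] = 1$ for all $1 \leq p < n$, and $[H, t^n] = 1$. $\Gamma$ has *commuting $\mathbb{Z}$-conjugates* if for every finitely generated subgroup $H \leq \Gamma$ there exists $t \in \Gamma$ such that $[H, {}^{t^p} H] = 1$ for all integers $p \geq 1$. *)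

theory Defs
  imports "HOL-Algebra.Generated_Groups" "HOL-Library.Countable_Set"
begin

definition conjugate :: "('a, 'b) monoid_scheme \<Rightarrow> 'a \<Rightarrow> 'a \<Rightarrow> 'a"
  where "conjugate G t g = t \<otimes>\<^bsub>G\<^esub> g \<otimes>\<^bsub>G\<^esub> inv\<^bsub>G\<^esub> t"

definition conjugate_set :: "('a, 'b) monoid_scheme \<Rightarrow> 'a \<Rightarrow> 'a set \<Rightarrow> 'a set"
  where "conjugate_set G t H = conjugate G t ` H"

(* [H, K]; the commutator [H, t] with an element t is the case K = {t}. *)
definition commutator :: "('a, 'b) monoid_scheme \<Rightarrow> 'a set \<Rightarrow> 'a set \<Rightarrow> 'a set"
  where "commutator G H K =
    generate G {h \<otimes>\<^bsub>G\<^esub> k \<otimes>\<^bsub>G\<^esub> inv\<^bsub>G\<^esub> h \<otimes>\<^bsub>G\<^esub> inv\<^bsub>G\<^esub> k | h k. h \<in> H \<and> k \<in> K}"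

definition fin_gen_subgroup :: "'a set \<Rightarrow> ('a, 'b) monoid_scheme \<Rightarrow> bool"
  where "fin_gen_subgroup H G \<longleftrightarrow>
    (\<exists>S. finite S \<and> S \<subseteq> carrier G \<and> H = generate G S)"

definition locally_finite_group :: "('a, 'b) monoid_scheme \<Rightarrow> bool"
  where "locally_finite_group G \<longleftrightarrow>
    group G \<and> (\<forall>H. fin_gen_subgroup H G \<longrightarrow> finite H)"

(* The finite groups F range over groups whose elements are natural numbers. Every
   finite group, over whatever type, is isomorphic to one of these, so this is no
   restriction. Two embeddings are conjugate pointwise, by one element of U. *)
definition hall_universal_group :: "('a, 'b) monoid_scheme \<Rightarrow> bool"
  where "hall_universal_group U \<longleftrightarrow>
    locally_finite_group U \<and> countable (carrier U) \<and>
    (\<forall>F :: nat monoid. group F \<and> finite (carrier F) \<longrightarrow> mon F U \<noteq> {}) \<and>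
    (\<forall>F :: nat monoid. group F \<and> finite (carrier F) \<longrightarrow>
      (\<forall>\<phi> \<in> mon F U. \<forall>\<psi> \<in> mon F U.
        \<exists>u \<in> carrier U. \<forall>x \<in> carrier F. \<psi> x = conjugate U u (\<phi> x)))"

definition mitotic :: "('a, 'b) monoid_scheme \<Rightarrow> bool"
  where "mitotic G \<longleftrightarrow>
    (\<forall>H. fin_gen_subgroup H G \<longrightarrow>
      (\<exists>t1 \<in> carrier G. \<exists>t2 \<in> carrier G.
        commutator G H (conjugate_set G t1 H) = {\<one>\<^bsub>G\<^esub>} \<and>
        (\<forall>h \<in> H. conjugate G t2 h = h \<otimes>\<^bsub>G\<^esub> conjugate G t1 h)))"

definition commuting_Z_mod_conjugates :: "nat \<Rightarrow> ('a, 'b) monoid_scheme \<Rightarrow> bool"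
  where "commuting_Z_mod_conjugates n G \<longleftrightarrow>
    (\<forall>H. fin_gen_subgroup H G \<longrightarrow>
      (\<exists>t \<in> carrier G.
        (\<forall>p::nat. 1 \<le> p \<and> p < n \<longrightarrow>
          commutator G H (conjugate_set G (t [^]\<^bsub>G\<^esub> p) H) = {\<one>\<^bsub>G\<^esub>}) \<and>
        commutator G H {t [^]\<^bsub>G\<^esub> n} = {\<one>\<^bsub>G\<^esub>}))"

definition commuting_Z_conjugates :: "('a, 'b) monoid_scheme \<Rightarrow> bool"
  where "commuting_Z_conjugates G \<longleftrightarrow>
    (\<forall>H. fin_gen_subgroup H G \<longrightarrow>
      (\<exists>t \<in> carrier G. \<forall>p::nat. 1 \<le> p \<longrightarrow>
        commutator G H (conjugate_set G (t [^]\<^bsub>G\<^esub> p) H) = {\<one>\<^bsub>G\<^esub>}))"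

end

theory Submission
  imports Defs "HOL-Algebra.Weak_Morphisms" "HOL-Algebra.Product_Groups" "HOL-Algebra.Sym_Groups"
    "HOL-Algebra.Multiplicative_Group"
begin

text \<open>
  Conjugacy of embeddings makes \<open>U\<close> homogeneous over its finite subgroups: an embedding of a
  finite subgroup \<open>H\<close> into a finite group \<open>F\<close> extends back to an embedding of \<open>F\<close> into \<open>U\<close>
  that is the identity on \<open>H\<close>. Apply this to \<open>F = H\<^sup>n\<close>, with \<open>H\<close> as one coordinate. The
  cyclic shift of \<open>H\<^sup>n\<close> is then realised by conjugation with an element \<open>t\<close>, so the conjugates of
  \<open>H\<close> by \<open>t\<^sup>p\<close> are the coordinate copies of \<open>H\<close>, and \<open>t\<^sup>n\<close> centralises \<open>H\<close>. For \<open>n = 2\<close> the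
  diagonal copy of \<open>H\<close> is also conjugate to \<open>H\<close>, whence mitosis. On the other hand, every \<open>t\<close>
  in \<open>U\<close> has a finite order \<open>m > 0\<close>, and \<open>[H, t\<^sup>m H t\<^sup>-\<^sup>m] = [H, H]\<close> is nontrivial for a
  nonabelian \<open>H\<close>.
\<close>

section \<open>Commutators and conjugation\<close>

context group
begin

text \<open>A generated subgroup is trivial exactly when its generators are. Every commutator
  condition thus becomes elementwise commutation; arbitrary subsets are allowed so that
  \<open>[H, t]\<close> with a single element is covered.\<close>

lemma commutator_trivial_iff:
  assumes "H \<subseteq> carrier G" "K \<subseteq> carrier G"
  shows "commutator G H K = {\<one>} \<longleftrightarrow> (\<forall>h\<in>H. \<forall>k\<in>K. h \<otimes> k = k \<otimes> h)"
proof -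
  let ?S = "{h \<otimes> k \<otimes> inv h \<otimes> inv k | h k. h \<in> H \<and> k \<in> K}"
  have eq: "h \<otimes> k \<otimes> inv h \<otimes> inv k = \<one> \<longleftrightarrow> h \<otimes> k = k \<otimes> h" if "h \<in> H" "k \<in> K" for h k
  proof -
    have hk: "h \<in> carrier G" "k \<in> carrier G" using that assms by auto
    have "h \<otimes> k \<otimes> inv h \<otimes> inv k = (h \<otimes> k) \<otimes> inv (k \<otimes> h)"
      using hk by (simp add: inv_mult_group m_assoc)
    then show ?thesis
      using hk by (metis inv_equality inv_inv m_closed r_inv inv_closed)
  qed
  have "generate G ?S = {\<one>} \<longleftrightarrow> ?S \<subseteq> {\<one>}"
  proof
    assume "generate G ?S = {\<one>}"
    then show "?S \<subseteq> {\<one>}" using generate.incl[of _ ?S G] by blast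
  next
    assume "?S \<subseteq> {\<one>}"
    then have "generate G ?S \<subseteq> {\<one>}"
      using generate_subgroup_incl[OF _ triv_subgroup] by blast
    then show "generate G ?S = {\<one>}" using generate.one[of G ?S] by blast
  qed
  then show ?thesis unfolding commutator_def using eq by blast
qed

lemma conjugate_closed:
  "\<lbrakk>t \<in> carrier G; x \<in> carrier G\<rbrakk> \<Longrightarrow> conjugate G t x \<in> carrier G"
  by (simp add: conjugate_def)

lemma conjugate_one: "x \<in> carrier G \<Longrightarrow> conjugate G \<one> x = x"
  by (simp add: conjugate_def)

lemma conjugate_mult:
  assumes "s \<in> carrier G" "t \<in> carrier G" "x \<in> carrier G"
  shows "conjugate G (s \<otimes> t) x = conjugate G s (conjugate G t x)"
  using assms by (simp add: conjugate_def inv_mult_group m_assoc)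

lemma conjugate_mon:
  assumes t: "t \<in> carrier G"
  shows "conjugate G t \<in> mon G G"
proof -
  have "conjugate G t (x \<otimes> y) = conjugate G t x \<otimes> conjugate G t y"
    if "x \<in> carrier G" "y \<in> carrier G" for x y
  proof -
    have "inv t \<otimes> (t \<otimes> (y \<otimes> inv t)) = y \<otimes> inv t"
      using that t by (metis inv_closed l_inv l_one m_assoc m_closed)
    then show ?thesis using that t by (simp add: conjugate_def m_assoc)
  qed
  moreover have "inj_on (conjugate G t) (carrier G)"
    using t by (auto simp: inj_on_def conjugate_def)
  ultimately show ?thesis
    using t by (auto simp: mon_def hom_def conjugate_closed)
qed

lemma fixed_by_conjugation_iff:
  assumes "t \<in> carrier G" "x \<in> carrier G"
  shows "conjugate G t x = x \<longleftrightarrow> x \<otimes> t = t \<otimes> x"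
  using assms by (metis conjugate_def inv_solve_right m_closed)

text \<open>Lagrange's theorem in the finite cyclic group generated by \<open>x\<close>: its order
  serves as \<open>m\<close>.\<close>

lemma finite_generate_singleton_imp_pow_eq_one:
  assumes x: "x \<in> carrier G" and fin: "finite (generate G {x})"
  obtains m :: nat where "m > 0" "x [^] m = \<one>"
proof -
  let ?K = "G\<lparr>carrier := generate G {x}\<rparr>"
  have sub: "subgroup (generate G {x}) G" using x by (intro generate_is_subgroup) auto
  interpret K: group ?K by (rule subgroup_imp_group[OF sub])
  have xK: "x \<in> carrier ?K" by (simp add: generate.incl)
  have "x [^] order ?K = \<one>"
    using K.pow_order_eq_1[OF xK] by (simp flip: nat_pow_consistent)
  moreover have "order ?K > 0" using fin K.order_gt_0_iff_finite by simp
  ultimately show thesis using that[of "order ?K"] by simp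
qed

end

lemma mon_compose: "\<lbrakk>f \<in> mon G H; g \<in> mon H K\<rbrakk> \<Longrightarrow> g \<circ> f \<in> mon G K"
  unfolding mon_def
  using hom_carrier by (fastforce intro: hom_compose comp_inj_on elim: inj_on_subset)

lemma inclusion_mon: "H \<subseteq> carrier G \<Longrightarrow> (\<lambda>x. x) \<in> mon (G\<lparr>carrier := H\<rparr>) G"
  by (auto simp: mon_def hom_def)

text \<open>The definition of Hall's group speaks only of groups on \<open>nat\<close>. Transporting
  a finite group along an injection into \<open>nat\<close> makes its clauses available for
  subgroups of \<open>U\<close> and their powers.\<close>

lemma finite_group_iso_nat_group:
  assumes "group F" "finite (carrier F)"
  obtains N :: "nat monoid" and f where "group N" "finite (carrier N)" "f \<in> iso F N"
proof -
  obtain f :: "_ \<Rightarrow> nat" where inj: "inj_on f (carrier F)"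
    using finite_imp_inj_to_nat_seg[OF assms(2)] by blast
  have iso: "f \<in> iso F (image_group f F)" by (rule inj_imp_image_group_iso[OF inj])
  have "group (image_group f F)"
    using group.iso_imp_img_group[OF assms(1) iso] by (simp add: image_group_def)
  moreover have "finite (carrier (image_group f F))" using assms(2) by (simp add: image_group_carrier)
  ultimately show thesis using that iso by blast
qed

section \<open>Homogeneity of Hall's group\<close>

locale hall_group = group U for U (structure) +
  assumes hall: "hall_universal_group U"
begin

lemma finite_fin_gen: "fin_gen_subgroup H U \<Longrightarrow> finite H"
  using hall by (auto simp: hall_universal_group_def locally_finite_group_def)

lemma fin_gen_imp_subgroup: "fin_gen_subgroup H U \<Longrightarrow> subgroup H U"
  by (auto simp: fin_gen_subgroup_def generate_is_subgroup)

lemma finite_group_embeds: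
  assumes "group F" "finite (carrier F)"
  obtains \<phi> where "\<phi> \<in> mon F U"
proof -
  obtain N :: "nat monoid" and f where N: "group N" "finite (carrier N)" "f \<in> iso F N"
    using finite_group_iso_nat_group[OF assms] by blast
  then obtain \<phi> where "\<phi> \<in> mon N U"
    using hall unfolding hall_universal_group_def by blast
  then have "\<phi> \<circ> f \<in> mon F U" using N(3) by (auto simp: iso_iff_mon_epi intro: mon_compose)
  then show thesis using that by blast
qed

lemma embeddings_conjugate:
  assumes F: "group F" "finite (carrier F)" and \<phi>: "\<phi> \<in> mon F U" and \<psi>: "\<psi> \<in> mon F U"
  obtains u where "u \<in> carrier U" "\<And>x. x \<in> carrier F \<Longrightarrow> \<psi> x = conjugate U u (\<phi> x)"
proof -
  obtain N :: "nat monoid" and f where N: "group N" "finite (carrier N)" and f: "f \<in> iso F N"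
    using finite_group_iso_nat_group[OF F] by blast
  define g where "g = inv_into (carrier F) f"
  have g: "g \<in> mon N F"
    using group.iso_set_sym[OF F(1) f] by (simp add: g_def iso_iff_mon_epi)
  \<comment> \<open>Both embeddings are precomposed with the same isomorphism, so an element
    conjugating the composites also conjugates the originals.\<close>
  have "\<phi> \<circ> g \<in> mon N U" "\<psi> \<circ> g \<in> mon N U" using g \<phi> \<psi> by (auto intro: mon_compose)
  then obtain u where u: "u \<in> carrier U"
    "\<forall>y\<in>carrier N. (\<psi> \<circ> g) y = conjugate U u ((\<phi> \<circ> g) y)"
    using hall N unfolding hall_universal_group_def by blast
  show thesis
  proof (rule that[OF u(1)])
    fix x assume x: "x \<in> carrier F"
    then have "f x \<in> carrier N" "g (f x) = x"
      using f by (auto simp: g_def iso_def bij_betw_def)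
    then show "\<psi> x = conjugate U u (\<phi> x)" using u(2) by fastforce
  qed
qed

text \<open>For an arbitrary embedding \<open>\<phi>\<close> of \<open>F\<close>, the maps
  \<open>\<phi> \<circ> i\<close> and the inclusion both embed \<open>H\<close> into
  \<open>U\<close>, hence are conjugate. Correcting \<open>\<phi>\<close> by the conjugating element
  gives \<open>j\<close>.\<close>

lemma embedding_extends:
  assumes H: "subgroup H U" "finite H" and F: "group F" "finite (carrier F)"
    and i: "i \<in> mon (U\<lparr>carrier := H\<rparr>) F"
  obtains j where "j \<in> mon F U" "\<And>h. h \<in> H \<Longrightarrow> j (i h) = h"
proof -
  obtain \<phi> where \<phi>: "\<phi> \<in> mon F U" using finite_group_embeds[OF F] by blast
  have inc: "(\<lambda>x. x) \<in> mon (U\<lparr>carrier := H\<rparr>) U"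
    using H(1) by (intro inclusion_mon subgroup.subset)
  have grp: "group (U\<lparr>carrier := H\<rparr>)" by (rule subgroup_imp_group[OF H(1)])
  obtain u where u: "u \<in> carrier U" "\<And>h. h \<in> H \<Longrightarrow> h = conjugate U u ((\<phi> \<circ> i) h)"
    using embeddings_conjugate[OF grp _ mon_compose[OF i \<phi>] inc] H(2) by auto
  have "conjugate U u \<circ> \<phi> \<in> mon F U" using \<phi> conjugate_mon[OF u(1)] by (rule mon_compose)
  then show thesis using that u(2) by force
qed

end

section \<open>Coordinate copies in a power of a group\<close>

definition coord :: "('a, 'b) monoid_scheme \<Rightarrow> nat \<Rightarrow> nat \<Rightarrow> 'a \<Rightarrow> nat \<Rightarrow> 'a"
  where "coord G n p h = (\<lambda>i\<in>{..<n}. if i = p then h else \<one>\<^bsub>G\<^esub>)"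

text \<open>The entry at position \<open>i\<close> moves to \<open>Suc i mod n\<close>. The case
  distinction stands for subtraction modulo \<open>n\<close>, since subtraction on
  \<open>nat\<close> truncates at 0.\<close>

definition cyclic_shift :: "nat \<Rightarrow> (nat \<Rightarrow> 'a) \<Rightarrow> nat \<Rightarrow> 'a"
  where "cyclic_shift n x = (\<lambda>i\<in>{..<n}. x (if i = 0 then n - 1 else i - 1))"

abbreviation power_group :: "nat \<Rightarrow> ('a, 'b) monoid_scheme \<Rightarrow> (nat \<Rightarrow> 'a) monoid"
  where "power_group n G \<equiv> product_group {..<n} (\<lambda>_. G)"

lemma cyclic_shift_coord:
  "p < n \<Longrightarrow> cyclic_shift n (coord G n p h) = coord G n (Suc p mod n) h"
  by (auto simp: cyclic_shift_def coord_def fun_eq_iff mod_Suc restrict_def)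

lemma cyclic_shift_mon: "cyclic_shift n \<in> mon (power_group n G) (power_group n G)"
proof -
  have "inj_on (cyclic_shift n) (carrier (power_group n G))"
  proof (rule inj_onI)
    fix x y :: "nat \<Rightarrow> 'a"
    assume x: "x \<in> carrier (power_group n G)" and y: "y \<in> carrier (power_group n G)"
      and eq: "cyclic_shift n x = cyclic_shift n y"
    have shift: "cyclic_shift n z (Suc i mod n) = z i" if "i < n" for z :: "nat \<Rightarrow> 'a" and i
      using that by (auto simp: cyclic_shift_def mod_Suc)
    have "x i = y i" if "i < n" for i using shift[OF that] eq by metis
    then show "x = y" using x y by (auto intro: PiE_ext)
  qed
  moreover have "cyclic_shift n \<in> hom (power_group n G) (power_group n G)"
    by (rule homI) (auto simp: cyclic_shift_def fun_eq_iff PiE_iff extensional_def restrict_def)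
  ultimately show ?thesis by (simp add: mon_def)
qed

context group
begin

lemma coord_mon:
  assumes "p < n"
  shows "coord G n p \<in> mon G (power_group n G)"
proof -
  have "inj_on (coord G n p) (carrier G)"
  proof (rule inj_onI)
    fix x y assume "coord G n p x = coord G n p y"
    then have "coord G n p x p = coord G n p y p" by simp
    then show "x = y" using assms by (simp add: coord_def)
  qed
  moreover have "coord G n p \<in> hom G (power_group n G)"
    by (rule homI) (auto simp: coord_def fun_eq_iff restrict_def split: if_splits)
  ultimately show ?thesis by (simp add: mon_def)
qed

text \<open>At every position at least one of the two factors has the entry one.\<close>

lemma coord_commute:
  assumes "p \<noteq> q" "h \<in> carrier G" "k \<in> carrier G"
  shows "coord G n p h \<otimes>\<^bsub>power_group n G\<^esub> coord G n q k
       = coord G n q k \<otimes>\<^bsub>power_group n G\<^esub> coord G n p h"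
  using assms by (auto simp: coord_def fun_eq_iff restrict_def)

lemma diagonal_mon:
  assumes "n > 0"
  shows "(\<lambda>h. \<lambda>i\<in>{..<n}. h) \<in> mon G (power_group n G)"
proof -
  have "inj_on (\<lambda>h. \<lambda>i\<in>{..<n}. h) (carrier G)"
    using assms by (metis (mono_tags, lifting) inj_onI lessThan_iff restrict_apply')
  moreover have "(\<lambda>h. \<lambda>i\<in>{..<n}. h) \<in> hom G (power_group n G)"
    by (rule homI) (auto simp: fun_eq_iff restrict_def split: if_splits)
  ultimately show ?thesis by (simp add: mon_def)
qed

lemma diagonal_eq_coord_mult:
  assumes "h \<in> carrier G"
  shows "(\<lambda>i\<in>{..<2}. h) = coord G 2 0 h \<otimes>\<^bsub>power_group 2 G\<^esub> coord G 2 1 h"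
  using assms by (auto simp: coord_def fun_eq_iff restrict_def)

end

section \<open>The three properties\<close>

context hall_group
begin

text \<open>Embed the power of \<open>H\<close> by \<open>j\<close> so that coordinate 0 is
  \<open>H\<close> itself. Then \<open>j\<close> and \<open>j \<circ> cyclic_shift n\<close> are two
  embeddings of one finite group, and \<open>t\<close> is an element conjugating the first to the
  second. Powers of \<open>t\<close> therefore carry \<open>H\<close> around the coordinates,
  returning to coordinate 0 at multiples of \<open>n\<close>.\<close>

lemma power_extension:
  assumes H: "subgroup H U" "finite H" and n: "n > 0"
  obtains j t where "j \<in> mon (power_group n (U\<lparr>carrier := H\<rparr>)) U" "t \<in> carrier U"
    "\<And>p h. h \<in> H \<Longrightarrow>
      conjugate U (t [^] (p::nat)) h = j (coord (U\<lparr>carrier := H\<rparr>) n (p mod n) h)"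
proof -
  let ?H = "U\<lparr>carrier := H\<rparr>"
  let ?P = "power_group n ?H"
  interpret H: group ?H by (rule subgroup_imp_group[OF H(1)])
  have P: "group ?P" by (rule product_group) (rule H.group_axioms)
  have finP: "finite (carrier ?P)" using H(2) by (simp add: finite_PiE)
  obtain j where j: "j \<in> mon ?P U" and j0: "\<And>h. h \<in> H \<Longrightarrow> j (coord ?H n 0 h) = h"
    using embedding_extends[OF H P finP H.coord_mon[OF n]] by blast
  obtain t where t: "t \<in> carrier U"
    and tj: "\<And>x. x \<in> carrier ?P \<Longrightarrow> (j \<circ> cyclic_shift n) x = conjugate U t (j x)"
    using embeddings_conjugate[OF P finP j mon_compose[OF cyclic_shift_mon j]] by blast
  have "conjugate U (t [^] p) h = j (coord ?H n (p mod n) h)" if h: "h \<in> H" for p :: nat and h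
  proof (induction p)
    case 0
    then show ?case using h j0 H(1) by (auto simp: conjugate_one dest: subgroup.mem_carrier)
  next
    case (Suc p)
    have hU: "h \<in> carrier U" using h H(1) by (rule subgroup.mem_carrier[rotated])
    have mem: "coord ?H n (p mod n) h \<in> carrier ?P"
      using h H.one_closed by (auto simp: coord_def)
    \<comment> \<open>The new factor \<open>t\<close> is split off on the left, so that it acts
      last, on the coordinate copy given by the induction hypothesis.\<close>
    have "conjugate U (t [^] Suc p) h = conjugate U t (conjugate U (t [^] p) h)"
      using t hU by (simp only: nat_pow_Suc2 conjugate_mult nat_pow_closed)
    also have "\<dots> = j (cyclic_shift n (coord ?H n (p mod n) h))"
      using tj[OF mem] Suc by simp
    also have "cyclic_shift n (coord ?H n (p mod n) h) = coord ?H n (Suc p mod n) h"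
      using n by (simp add: cyclic_shift_coord mod_Suc_eq)
    finally show ?case .
  qed
  then show thesis using that j t by blast
qed

lemma coord_images_commute:
  assumes H: "subgroup H U" and j: "j \<in> mon (power_group n (U\<lparr>carrier := H\<rparr>)) U"
    and pq: "p \<noteq> q" and hk: "h \<in> H" "k \<in> H"
  shows "j (coord (U\<lparr>carrier := H\<rparr>) n p h) \<otimes> j (coord (U\<lparr>carrier := H\<rparr>) n q k)
       = j (coord (U\<lparr>carrier := H\<rparr>) n q k) \<otimes> j (coord (U\<lparr>carrier := H\<rparr>) n p h)"
proof -
  let ?H = "U\<lparr>carrier := H\<rparr>"
  interpret H: group ?H by (rule subgroup_imp_group[OF H])
  have mem: "coord ?H n r x \<in> carrier (power_group n ?H)" if "x \<in> H" for r x
    using that H.one_closed by (auto simp: coord_def)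
  have hom: "j \<in> hom (power_group n ?H) U" using j by (simp add: mon_def)
  show ?thesis
    using H.coord_commute[OF pq, of h k n] hk
      hom_mult[OF hom mem[of h p] mem[of k q]] hom_mult[OF hom mem[of k q] mem[of h p]]
    by (simp del: mult_product_group)
qed

lemma mitotic: "mitotic U"
  unfolding mitotic_def
proof (intro allI impI)
  fix H assume fg: "fin_gen_subgroup H U"
  note H = fin_gen_imp_subgroup[OF fg] finite_fin_gen[OF fg]
  let ?H = "U\<lparr>carrier := H\<rparr>"
  interpret H: group ?H by (rule subgroup_imp_group[OF H(1)])
  have HU: "H \<subseteq> carrier U" using H(1) by (rule subgroup.subset)
  obtain j t where j: "j \<in> mon (power_group 2 ?H) U" and t: "t \<in> carrier U"
    and jt: "\<And>p h. h \<in> H \<Longrightarrow> conjugate U (t [^] (p::nat)) h = j (coord ?H 2 (p mod 2) h)"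
    using power_extension[OF H, of 2] by auto
  have j0: "j (coord ?H 2 0 h) = h" if "h \<in> H" for h
    using jt[OF that, of 0] that HU by (auto simp: conjugate_one)
  have j1: "j (coord ?H 2 1 h) = conjugate U t h" if "h \<in> H" for h
    using jt[OF that, of 1] t by simp
  have diag: "j \<circ> (\<lambda>h. \<lambda>i\<in>{..<2}. h) \<in> mon ?H U"
    by (rule mon_compose[OF H.diagonal_mon j]) simp
  have finH: "finite (carrier ?H)" using H(2) by simp
  \<comment> \<open>The inclusion of \<open>H\<close> and its diagonal embedding are conjugate by
    \<open>s\<close>, which becomes \<open>t2\<close>, while \<open>t\<close> becomes
    \<open>t1\<close>. The diagonal is the product of the two coordinate copies, which are
    \<open>H\<close> and its conjugate by \<open>t\<close>.\<close>
  obtain s where s: "s \<in> carrier U"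
    and "\<And>h. h \<in> carrier ?H \<Longrightarrow> (j \<circ> (\<lambda>h. \<lambda>i\<in>{..<2}. h)) h = conjugate U s h"
    using embeddings_conjugate[OF H.group_axioms finH inclusion_mon[OF HU] diag] by blast
  then have sj: "conjugate U s h = j (\<lambda>i\<in>{..<2}. h)" if "h \<in> H" for h
    using that by fastforce
  have "conjugate U s h = h \<otimes> conjugate U t h" if h: "h \<in> H" for h
  proof -
    have hom: "j \<in> hom (power_group 2 ?H) U" using j by (simp add: mon_def)
    have mem: "coord ?H 2 r h \<in> carrier (power_group 2 ?H)" for r
      using h H.one_closed by (auto simp: coord_def)
    have "conjugate U s h = j (coord ?H 2 0 h \<otimes>\<^bsub>power_group 2 ?H\<^esub> coord ?H 2 1 h)"
      using sj[OF h] H.diagonal_eq_coord_mult[of h] h by (simp del: mult_product_group)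
    also have "\<dots> = h \<otimes> conjugate U t h"
      using hom_mult[OF hom mem mem] j0[OF h] j1[OF h] by simp
    finally show ?thesis .
  qed
  moreover have "commutator U H (conjugate_set U t H) = {\<one>}"
  proof -
    have "conjugate_set U t H \<subseteq> carrier U"
      using HU t by (auto simp: conjugate_set_def conjugate_closed)
    moreover have "h \<otimes> conjugate U t k = conjugate U t k \<otimes> h" if "h \<in> H" "k \<in> H" for h k
      using coord_images_commute[OF H(1) j, of 0 1 h k] that by (simp add: j0 j1 flip: One_nat_def)
    ultimately show ?thesis
      using commutator_trivial_iff[OF HU] by (auto simp: conjugate_set_def)
  qed
  ultimately show "\<exists>t1\<in>carrier U. \<exists>t2\<in>carrier U.
      commutator U H (conjugate_set U t1 H) = {\<one>} \<and>
      (\<forall>h\<in>H. conjugate U t2 h = h \<otimes> conjugate U t1 h)"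
    using s t by blast
qed

lemma commuting_Z_mod_conjugates:
  assumes n: "n > 0"
  shows "commuting_Z_mod_conjugates n U"
  unfolding commuting_Z_mod_conjugates_def
proof (intro allI impI)
  fix H assume fg: "fin_gen_subgroup H U"
  note H = fin_gen_imp_subgroup[OF fg] finite_fin_gen[OF fg]
  let ?H = "U\<lparr>carrier := H\<rparr>"
  have HU: "H \<subseteq> carrier U" using H(1) by (rule subgroup.subset)
  obtain j t where j: "j \<in> mon (power_group n ?H) U" and t: "t \<in> carrier U"
    and jt: "\<And>p h. h \<in> H \<Longrightarrow> conjugate U (t [^] (p::nat)) h = j (coord ?H n (p mod n) h)"
    using power_extension[OF H n] by auto
  have j0: "j (coord ?H n 0 h) = h" if "h \<in> H" for h
    using jt[OF that, of 0] that HU by (auto simp: conjugate_one)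
  \<comment> \<open>For these \<open>p\<close> the residue \<open>p mod n\<close> is
    \<open>p\<close> itself, so the conjugate lies in a coordinate other than 0.\<close>
  have "commutator U H (conjugate_set U (t [^] p) H) = {\<one>}" if p: "1 \<le> p" "p < n" for p
  proof -
    have "conjugate_set U (t [^] p) H \<subseteq> carrier U"
      using HU t by (auto simp: conjugate_set_def conjugate_closed)
    moreover have "h \<otimes> conjugate U (t [^] p) k = conjugate U (t [^] p) k \<otimes> h"
      if "h \<in> H" "k \<in> H" for h k
      using coord_images_commute[OF H(1) j, of 0 p h k] that p by (simp add: j0 jt)
    ultimately show ?thesis
      using commutator_trivial_iff[OF HU] by (auto simp: conjugate_set_def)
  qed
  moreover have "commutator U H {t [^] n} = {\<one>}"
  proof -
    \<comment> \<open>As \<open>n mod n = 0\<close>, conjugation by the \<open>n\<close>-th power of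
      \<open>t\<close> brings \<open>h\<close> back to coordinate 0 and thus fixes it.\<close>
    have "h \<otimes> t [^] n = t [^] n \<otimes> h" if "h \<in> H" for h
      using jt[OF that, of n] j0[OF that] fixed_by_conjugation_iff[of "t [^] n" h] t that HU by auto
    then show ?thesis using commutator_trivial_iff[OF HU] t by auto
  qed
  ultimately show "\<exists>t\<in>carrier U.
      (\<forall>p::nat. 1 \<le> p \<and> p < n \<longrightarrow> commutator U H (conjugate_set U (t [^] p) H) = {\<one>}) \<and>
      commutator U H {t [^] n} = {\<one>}"
    using t by blast
qed

lemma noncommuting_elements:
  obtains a b where "a \<in> carrier U" "b \<in> carrier U" "a \<otimes> b \<noteq> b \<otimes> a"
proof -
  let ?S = "sym_group 3"
  have "finite (carrier ?S)" by (simp add: sym_group_def finite_permutations)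
  then obtain \<phi> where \<phi>: "\<phi> \<in> mon ?S U"
    using finite_group_embeds[OF sym_group_is_group] by blast
  define \<sigma> \<tau> :: "nat \<Rightarrow> nat" where "\<sigma> = transpose 1 2" and "\<tau> = transpose 2 3"
  have mem: "\<sigma> \<in> carrier ?S" "\<tau> \<in> carrier ?S"
    by (auto simp: \<sigma>_def \<tau>_def sym_group_carrier intro!: permutes_swap_id)
  \<comment> \<open>The left side is 2 and the right side is 3; injectivity of \<open>\<phi>\<close>
    carries this failure to commute into \<open>U\<close>.\<close>
  have "(\<sigma> \<circ> \<tau>) 1 \<noteq> (\<tau> \<circ> \<sigma>) 1" by (simp add: \<sigma>_def \<tau>_def transpose_def)
  then have "\<sigma> \<otimes>\<^bsub>?S\<^esub> \<tau> \<noteq> \<tau> \<otimes>\<^bsub>?S\<^esub> \<sigma>" by (metis sym_group_mult)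
  moreover have "\<sigma> \<otimes>\<^bsub>?S\<^esub> \<tau> \<in> carrier ?S" "\<tau> \<otimes>\<^bsub>?S\<^esub> \<sigma> \<in> carrier ?S"
    using mem group.is_monoid[OF sym_group_is_group] by (auto intro: monoid.m_closed)
  ultimately have "\<phi> (\<sigma> \<otimes>\<^bsub>?S\<^esub> \<tau>) \<noteq> \<phi> (\<tau> \<otimes>\<^bsub>?S\<^esub> \<sigma>)"
    using \<phi> by (auto simp: mon_def dest: inj_onD)
  then have "\<phi> \<sigma> \<otimes> \<phi> \<tau> \<noteq> \<phi> \<tau> \<otimes> \<phi> \<sigma>"
    using \<phi> mem hom_mult[of \<phi> ?S U] by (simp add: mon_def)
  then show thesis using that \<phi> mem by (auto simp: mon_def dest: hom_in_carrier)
qed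

lemma not_commuting_Z_conjugates: "\<not> commuting_Z_conjugates U"
proof
  assume comm: "commuting_Z_conjugates U"
  obtain a b where ab: "a \<in> carrier U" "b \<in> carrier U" "a \<otimes> b \<noteq> b \<otimes> a"
    by (rule noncommuting_elements)
  define H where "H = generate U {a, b}"
  have HU: "H \<subseteq> carrier U" using ab by (auto simp: H_def intro!: generate_incl)
  have "fin_gen_subgroup H U"
    unfolding fin_gen_subgroup_def H_def using ab by (intro exI[of _ "{a, b}"]) auto
  then obtain t where t: "t \<in> carrier U"
    and tc: "\<And>p::nat. 1 \<le> p \<Longrightarrow> commutator U H (conjugate_set U (t [^] p) H) = {\<one>}"
    using comm unfolding commuting_Z_conjugates_def by blast
  \<comment> \<open>Local finiteness applied to the cyclic subgroup of \<open>t\<close> yields a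
    positive exponent \<open>m\<close> that kills \<open>t\<close>.\<close>
  have "finite (generate U {t})"
    by (rule finite_fin_gen) (use t in \<open>auto simp: fin_gen_subgroup_def intro!: exI[of _ "{t}"]\<close>)
  then obtain m :: nat where m: "m > 0" "t [^] m = \<one>"
    using finite_generate_singleton_imp_pow_eq_one[OF t] by blast
  \<comment> \<open>Taking \<open>p = m\<close> in the assumed property now forces \<open>H\<close>
    to commute with itself, although it contains \<open>a\<close> and \<open>b\<close>.\<close>
  have "conjugate_set U (t [^] m) H = H"
    using HU by (force simp: m conjugate_set_def conjugate_one)
  then have "commutator U H H = {\<one>}" using tc[of m] m(1) by simp
  moreover have "a \<in> H" "b \<in> H" by (auto simp: H_def intro: generate.incl)
  ultimately show False using commutator_trivial_iff[OF HU HU] ab(3) by blast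
qed

end

theorem proposition3p17:
  fixes U :: "('a, 'b) monoid_scheme"
  assumes "hall_universal_group U"
  shows "mitotic U \<and>
    (\<forall>n::nat. n \<ge> 2 \<longrightarrow> commuting_Z_mod_conjugates n U) \<and>
    \<not> commuting_Z_conjugates U"
proof -
  interpret hall_group U
    using assms
    by (intro hall_group.intro hall_group_axioms.intro)
      (auto simp: hall_universal_group_def locally_finite_group_def)
  show ?thesis
    using mitotic commuting_Z_mod_conjugates not_commuting_Z_conjugates by auto
qed

end
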